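(* Let $p$ be an odd prime with $p\equiv 1\pmod 3$ and let $a$ be a positive integer. Then $$\sum_{k=0}^{\lfloor \frac{5}{6}p^a\rfloor}\frac{\binom{2k}{k}}{16^k}\equiv\left(\frac{3}{p^a}\right)\pmod{p^2},$$ where $\left(\frac{\cdot}{\cdot}\right)$ denotes the Jacobi symbol.
   Context: The congruence is understood for rational numbers whose denominators are coprime to $p$ (here the denominators are powers of $2$), i.e. $x\equiv y\pmod{p^2}$ means $x-y$ is $p^2$ times a rational number with denominator prime to $p$. *)

theory Defs
  imports "HOL-Number_Theory.Number_Theory"
begin

text \<open>
  The product is over the prime factors of \<open>n\<close> with multiplicity. The Jacobi symbol is only
  meaningful for odd positive \<open>n\<close>; other values of \<open>n\<close> are not excluded here.
\<close>

definition Jacobi :: "int \<Rightarrow> nat \<Rightarrow> int" where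
  "Jacobi m n = (\<Prod>q\<in>#prime_factorization n. Legendre m (int q))"

text \<open>
  Congruence of rational numbers modulo \<open>p ^ n\<close> in the localization of the integers at the
  prime \<open>p\<close>. The second component of \<open>quotient_of z\<close> is the denominator of \<open>z\<close> in lowest terms.
\<close>

definition rat_cong :: "nat \<Rightarrow> nat \<Rightarrow> rat \<Rightarrow> rat \<Rightarrow> bool" where
  "rat_cong p n x y \<longleftrightarrow>
     (\<exists>z. coprime (snd (quotient_of z)) (int p) \<and> x - y = of_nat (p ^ n) * z)"

end

theory Submission
  imports Defs "HOL-Computational_Algebra.Polynomial"
begin

text \<open>
  Write \<open>q = p ^ a = 6 * m + 1\<close>, so that the sum runs up to \<open>5 * m\<close>, and \<open>B\<close> for the Beta function.

  For \<open>k \<le> 3 * m\<close> the summand is congruent to \<open>(-1) ^ k * (3 * m + k choose 2 * k)\<close>, and these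
  signed binomials add up to \<open>(-1) ^ m\<close>, which is the Jacobi symbol. The summands at
  \<open>k = 3 * m + i\<close> with \<open>1 \<le> i \<le> 2 * m\<close> are congruent to a common constant times \<open>q * B(i, i)\<close>,
  so it remains to show that \<open>\<Sum>i. q * B(i, i)\<close> vanishes modulo \<open>p ^ 2\<close>.

  Modulo \<open>p ^ 2\<close>, and up to sign, \<open>q * B(\<alpha>, \<beta>)\<close> is symmetric in \<open>\<alpha>, \<beta>, \<gamma>\<close> where
  \<open>\<alpha> + \<beta> + \<gamma> = q + 1\<close>. Hence the integrands \<open>(x * (1 - x)) ^ (i - 1)\<close> may be replaced by their
  two images under the rotation \<open>x \<mapsto> 1 / (1 - x)\<close>. The three geometric sums add up to
  \<open>(1 - x ^ q - (1 - x) ^ q) / (1 - x + x ^ 2)\<close>, whose coefficients are divisible by \<open>p\<close>, and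
  a further factor \<open>p\<close> comes from \<open>q\<close> times the integral of a polynomial of degree below \<open>q - 1\<close>.
\<close>

section \<open>Localization at a prime\<close>

text \<open>The ideal generated by \<open>p ^ n\<close> in the localization of the integers at \<open>p\<close>.\<close>

definition ploc :: "nat \<Rightarrow> nat \<Rightarrow> rat set" where
  "ploc p n = {x. \<exists>a b. coprime b (int p) \<and> b \<noteq> 0 \<and> x = of_nat (p ^ n) * (of_int a / of_int b)}"

lemma plocI:
  assumes "coprime b (int p)" "b \<noteq> 0" "x = of_nat (p ^ n) * (of_int a / of_int b)"
  shows "x \<in> ploc p n"
  using assms unfolding ploc_def by blast

lemma plocE:
  assumes "x \<in> ploc p n"
  obtains a b where "coprime b (int p)" "b \<noteq> 0" "x = of_nat (p ^ n) * (of_int a / of_int b)"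
  using assms unfolding ploc_def by blast

text \<open>Frees the argument from reduced fractions. For the converse, the reduced denominator
  divides any other denominator and so inherits coprimality with \<open>p\<close>.\<close>

lemma rat_cong_iff_ploc: "rat_cong p n x y \<longleftrightarrow> x - y \<in> ploc p n"
proof
  assume "rat_cong p n x y"
  then obtain z where z: "coprime (snd (quotient_of z)) (int p)" "x - y = of_nat (p ^ n) * z"
    unfolding rat_cong_def by blast
  obtain a b where ab: "quotient_of z = (a, b)" by fastforce
  have "b > 0" using quotient_of_denom_pos[OF ab] .
  moreover have "z = of_int a / of_int b" using quotient_of_div[OF ab] .
  ultimately show "x - y \<in> ploc p n"
    using z ab by (intro plocI[of b]) auto
next
  assume "x - y \<in> ploc p n"
  then obtain a b where ab: "coprime b (int p)" "b \<noteq> 0"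
    "x - y = of_nat (p ^ n) * (of_int a / of_int b)" by (rule plocE)
  define z :: rat where "z = of_int a / of_int b"
  obtain c d where cd: "quotient_of z = (c, d)" by fastforce
  have "d > 0" using quotient_of_denom_pos[OF cd] .
  have "coprime c d" using quotient_of_coprime[OF cd] .
  have "z = of_int c / of_int d" using quotient_of_div[OF cd] .
  then have "(of_int (a * d) :: rat) = of_int (c * b)"
    using \<open>d > 0\<close> ab(2) by (simp add: z_def field_simps)
  then have "a * d = c * b" by (simp only: of_int_eq_iff)
  then have "d dvd c * b" by (metis dvd_triv_right)
  then have "d dvd b" using \<open>coprime c d\<close> by (simp add: coprime_dvd_mult_right_iff coprime_commute)
  then have "coprime d (int p)" using ab(1) by (metis coprime_divisors dvd_refl)
  then show "rat_cong p n x y"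
    unfolding rat_cong_def using ab(3) cd by (intro exI[of _ z]) (auto simp: z_def)
qed

lemma ploc_add: "x \<in> ploc p n \<Longrightarrow> y \<in> ploc p n \<Longrightarrow> x + y \<in> ploc p n"
proof (elim plocE)
  fix a b c d
  assume "coprime b (int p)" "b \<noteq> 0" "x = of_nat (p ^ n) * (of_int a / of_int b)"
    "coprime d (int p)" "d \<noteq> 0" "y = of_nat (p ^ n) * (of_int c / of_int d)"
  then show ?thesis
    by (intro plocI[of "b * d" p _ n "a * d + c * b"]) (auto simp: field_simps)
qed

lemma ploc_mult: "x \<in> ploc p m \<Longrightarrow> y \<in> ploc p n \<Longrightarrow> x * y \<in> ploc p (m + n)"
proof (elim plocE)
  fix a b c d
  assume "coprime b (int p)" "b \<noteq> 0" "x = of_nat (p ^ m) * (of_int a / of_int b)"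
    "coprime d (int p)" "d \<noteq> 0" "y = of_nat (p ^ n) * (of_int c / of_int d)"
  then show ?thesis
    by (intro plocI[of "b * d" p _ "m + n" "a * c"]) (auto simp: field_simps power_add)
qed

lemma ploc_of_int: "int p ^ n dvd k \<Longrightarrow> of_int k \<in> ploc p n"
  by (auto intro!: plocI[of 1] elim!: dvdE)

lemma ploc_of_int_0 [simp]: "of_int k \<in> ploc p 0"
  by (rule ploc_of_int) simp

lemma ploc_of_nat_0 [simp]: "of_nat k \<in> ploc p 0"
  using ploc_of_int_0[of "int k"] by simp

lemma ploc_mult_0: "x \<in> ploc p 0 \<Longrightarrow> y \<in> ploc p n \<Longrightarrow> x * y \<in> ploc p n"
  using ploc_mult[of x p 0 y n] by simp

lemma ploc_uminus: "x \<in> ploc p n \<Longrightarrow> - x \<in> ploc p n"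
  using ploc_mult_0[of "of_int (-1)" p x n] by (simp del: of_int_minus) simp

lemma ploc_diff: "x \<in> ploc p n \<Longrightarrow> y \<in> ploc p n \<Longrightarrow> x - y \<in> ploc p n"
  using ploc_add[of x p n "- y"] ploc_uminus by simp

lemma ploc_0 [simp]: "0 \<in> ploc p n"
  using ploc_of_int[of p n 0] by simp

lemma ploc_sum: "(\<And>i. i \<in> A \<Longrightarrow> f i \<in> ploc p n) \<Longrightarrow> sum f A \<in> ploc p n"
  by (induction A rule: infinite_finite_induct) (auto intro: ploc_add)

lemma ploc_antimono: "m \<le> n \<Longrightarrow> ploc p n \<subseteq> ploc p m"
proof
  fix x assume "m \<le> n" "x \<in> ploc p n"
  from this(2) obtain a b where ab: "coprime b (int p)" "b \<noteq> 0"
    "x = of_nat (p ^ n) * (of_int a / of_int b)" by (rule plocE)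
  have "p ^ n = p ^ m * p ^ (n - m)" using \<open>m \<le> n\<close> by (simp flip: power_add)
  then show "x \<in> ploc p m"
    using ab by (intro plocI[of b p _ m "int p ^ (n - m) * a"]) auto
qed

lemma ploc_inverse_of_int: "coprime b (int p) \<Longrightarrow> b \<noteq> 0 \<Longrightarrow> inverse (of_int b) \<in> ploc p 0"
  by (rule plocI[of b p _ 0 1]) (auto simp: field_simps)

text \<open>With \<open>x = c / b\<close> and \<open>c = b + p ^ n * a\<close>, the assumption
  \<open>n > 0\<close> keeps \<open>c\<close> prime to \<open>p\<close>, and
  \<open>inverse x - 1 = - p ^ n * a / c\<close>.\<close>

lemma ploc_inverse_unit:
  assumes "x - 1 \<in> ploc p n" "n > 0" "prime p"
  shows "inverse x - 1 \<in> ploc p n"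
proof -
  obtain a b where ab: "coprime b (int p)" "b \<noteq> 0"
    "x - 1 = of_nat (p ^ n) * (of_int a / of_int b)" using assms(1) by (rule plocE)
  define c where "c = b + int p ^ n * a"
  have "coprime c (int p)"
  proof -
    have "int p dvd int p ^ n * a" using assms(2) by (simp add: dvd_power)
    then have "c mod int p = b mod int p" unfolding c_def by (auto simp: mod_add_eq elim!: dvdE)
    then show ?thesis using ab(1) by (metis coprime_mod_left_iff of_nat_0_eq_iff not_prime_0 assms(3))
  qed
  moreover have "c \<noteq> 0"
  proof
    assume "c = 0"
    with \<open>coprime c (int p)\<close> have "is_unit (int p)" by simp
    then show False using assms(3) by (auto simp: prime_nat_iff)
  qed
  moreover have x: "x = of_int c / of_int b"
    using ab(2,3) by (simp add: c_def field_simps)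
  moreover have "inverse x - 1 = of_nat (p ^ n) * (of_int (- a) / of_int c)"
    using \<open>c \<noteq> 0\<close> ab(2) unfolding x by (simp add: field_simps) (simp add: c_def field_simps)
  ultimately show ?thesis by (intro plocI)
qed

text \<open>Expand \<open>x * y - 1 = (x - 1) * (y - 1) + (x - 1) + (y - 1)\<close>.\<close>

lemma ploc_unit_mult:
  assumes "x - 1 \<in> ploc p n" "y - 1 \<in> ploc p n"
  shows "x * y - 1 \<in> ploc p n"
proof -
  have "(x - 1) * (y - 1) \<in> ploc p n"
    using ploc_mult[OF assms] ploc_antimono[of n "n + n" p] by auto
  from ploc_add[OF this ploc_add[OF assms]] show ?thesis by (simp add: algebra_simps)
qed

lemma ploc_unit_prod:
  "(\<And>i. i \<in> A \<Longrightarrow> f i - 1 \<in> ploc p n) \<Longrightarrow> prod f A - 1 \<in> ploc p n"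
  by (induction A rule: infinite_finite_induct) (auto intro: ploc_unit_mult)

lemma ploc_cancel:
  assumes "of_int b * x \<in> ploc p n" "coprime b (int p)" "b \<noteq> 0"
  shows "x \<in> ploc p n"
  using ploc_mult_0[OF ploc_inverse_of_int[OF assms(2,3)] assms(1)] assms(3)
  by (simp add: field_simps)

text \<open>If \<open>p ^ k\<close> is the exact power of \<open>p\<close> in \<open>j\<close>, then
  \<open>p ^ k <= j < p ^ a\<close>, so a factor \<open>p\<close> survives in the quotient.\<close>

lemma prime_power_div_ploc:
  assumes "prime p" "0 < j" "j < p ^ a"
  shows "of_nat (p ^ a) / of_nat j \<in> ploc p 1"
proof -
  obtain k b where kb: "j = p ^ k * b" "\<not> p dvd b"
    using assms(1,2) by (metis not_prime_unit multiplicity_decompose'[of j p] neq0_conv)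
  have "b > 0" using kb assms(2) by (auto intro: Nat.gr0I)
  have "p ^ k < p ^ a"
    using assms(3) \<open>b > 0\<close> unfolding kb(1) by (intro le_less_trans[OF _ assms(3)[unfolded kb(1)]]) simp
  then have "k < a" using assms(1) power_less_imp_less_exp prime_gt_1_nat by blast
  then have "p ^ a = p ^ k * p * p ^ (a - Suc k)"
    by (metis Suc_leI le_add_diff_inverse power_Suc2 power_add)
  moreover have "coprime (int b) (int p)"
    using kb(2) assms(1) by (metis coprime_commute coprime_int_iff prime_imp_coprime_nat)
  ultimately show ?thesis using assms(1) \<open>b > 0\<close>
    by (intro plocI[of "int b" p _ 1 "int p ^ (a - Suc k)"]) (auto simp: kb(1) field_simps prime_gt_0_nat)
qed

section \<open>Binomial coefficients\<close>

text \<open>Put \<open>q = p ^ a\<close> in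
  \<open>k * (q choose k) = q * (q - 1 choose (k - 1))\<close>: were the binomial prime to
  \<open>p\<close>, then \<open>q\<close> would divide the smaller number \<open>k\<close>.\<close>

lemma prime_power_dvd_binomial:
  fixes p a k :: nat
  assumes "prime p" "0 < k" "k < p ^ a"
  shows "p dvd (p ^ a choose k)"
proof (rule ccontr)
  assume "\<not> p dvd (p ^ a choose k)"
  then have "coprime (p ^ a) (p ^ a choose k)"
    using assms(1) by (simp add: prime_imp_coprime_nat coprime_power_left_iff)
  moreover have "p ^ a dvd k * (p ^ a choose k)"
    using times_binomial_minus1_eq[of k "p ^ a"] assms(2) by simp
  ultimately have "p ^ a dvd k" by (simp add: coprime_dvd_mult_left_iff)
  then show False using assms(2,3) by (auto dest: dvd_imp_le)
qed

text \<open>By Pascal's rule, neighbours in row \<open>p ^ a - 1\<close> add up to an entry of row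
  \<open>p ^ a\<close> that \<open>p\<close> divides, so the sign alternates.\<close>

lemma prime_power_minus_one_binomial_cong:
  assumes "prime p" "j < p ^ a"
  shows "[int (p ^ a - 1 choose j) = (- 1) ^ j] (mod int p)"
  using assms(2)
proof (induction j)
  case (Suc j)
  have "p ^ a choose Suc j = (p ^ a - 1 choose j) + (p ^ a - 1 choose Suc j)"
    using Suc.prems by (metis Suc_diff_1 binomial_Suc_Suc gr_zeroI not_less_zero)
  then have "int p dvd int (p ^ a - 1 choose j) + int (p ^ a - 1 choose Suc j)"
    using prime_power_dvd_binomial[OF assms(1), of "Suc j" a] Suc.prems
    by (metis of_nat_add of_nat_dvd_iff zero_less_Suc)
  moreover have "int p dvd int (p ^ a - 1 choose j) - (- 1) ^ j"
    using Suc by (simp add: cong_iff_dvd_diff)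
  ultimately have "int p dvd int (p ^ a - 1 choose j) + int (p ^ a - 1 choose Suc j)
      - (int (p ^ a - 1 choose j) - (- 1) ^ j)" by (rule dvd_diff)
  then show ?case by (simp add: cong_iff_dvd_diff)
qed simp

text \<open>Pascal's rule termwise; the extra top terms are zero binomials. The companion sum
  \<open>B\<close> closes the recurrence.\<close>

lemma alternating_binomial_sum_rec:
  fixes n :: nat
  defines "A \<equiv> \<lambda>n. \<Sum>k\<le>n. (- 1 :: int) ^ k * int (n + k choose (2 * k))"
    and "B \<equiv> \<lambda>n. \<Sum>k\<le>n. (- 1 :: int) ^ k * int (n + k + 1 choose (2 * k + 1))"
  shows "A (Suc n) = A n - B n" and "B (Suc n) = B n + A (Suc n)"
proof -
  have "A (Suc n) = 1 + (\<Sum>k\<le>n. (- 1) ^ Suc k * int (Suc n + Suc k choose (2 * Suc k)))"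
    unfolding A_def by (subst sum.atMost_Suc_shift) simp
  also have "(\<Sum>k\<le>n. (- 1) ^ Suc k * int (Suc n + Suc k choose (2 * Suc k)))
      = (\<Sum>k\<le>n. (- 1) ^ Suc k * int (n + Suc k choose (2 * Suc k))) - B n"
    unfolding B_def sum_subtractf[symmetric]
    by (intro sum.cong) (simp_all add: algebra_simps)
  also have "1 + (\<dots>) = 1 + (\<Sum>k\<le>n. (- 1) ^ Suc k * int (n + Suc k choose (2 * Suc k))) - B n"
    by simp
  also have "1 + (\<Sum>k\<le>n. (- 1) ^ Suc k * int (n + Suc k choose (2 * Suc k)))
      = (\<Sum>k\<le>Suc n. (- 1) ^ k * int (n + k choose (2 * k)))"
    by (subst sum.atMost_Suc_shift) simp
  also have "\<dots> = A n" unfolding A_def by (simp add: binomial_eq_0)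
  finally show "A (Suc n) = A n - B n" .
  have "B (Suc n) = (\<Sum>k\<le>Suc n. (- 1) ^ k * int (n + k + 1 choose (2 * k + 1))) + A (Suc n)"
    unfolding A_def B_def by (simp add: sum.distrib algebra_simps del: sum.atMost_Suc)
  also have "(\<Sum>k\<le>Suc n. (- 1) ^ k * int (n + k + 1 choose (2 * k + 1))) = B n"
    unfolding B_def by (simp add: binomial_eq_0)
  finally show "B (Suc n) = B n + A (Suc n)" .
qed

text \<open>The recurrence sends \<open>(A, B)\<close> to \<open>(A - B, A)\<close>, and three such
  steps negate the pair.\<close>

lemma alternating_binomial_sum:
  "(\<Sum>k\<le>3 * m. (- 1 :: int) ^ k * int (3 * m + k choose (2 * k))) = (- 1) ^ m"
proof -
  define A where "A = (\<lambda>n. \<Sum>k\<le>n. (- 1 :: int) ^ k * int (n + k choose (2 * k)))"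
  define B where "B = (\<lambda>n. \<Sum>k\<le>n. (- 1 :: int) ^ k * int (n + k + 1 choose (2 * k + 1)))"
  have rec: "A (Suc n) = A n - B n" "B (Suc n) = B n + A (Suc n)" for n
    using alternating_binomial_sum_rec[of n] by (simp_all add: A_def B_def)
  have "A (3 * m) = (- 1) ^ m \<and> B (3 * m) = (- 1) ^ m"
  proof (induction m)
    case 0
    show ?case by (simp add: A_def B_def)
  next
    case (Suc m)
    have "3 * Suc m = Suc (Suc (Suc (3 * m)))" by simp
    then show ?case using Suc by (simp only: rec) simp
  qed
  then show ?thesis by (simp add: A_def)
qed

section \<open>Product formula for central binomial coefficients up to the middle index\<close>

lemma of_nat_central_binomial_Suc:
  "of_nat (2 * Suc k choose Suc k) =
    (of_nat (2 * k choose k) * (2 * (2 * of_nat k + 1)) / (of_nat k + 1) :: rat)"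
proof -
  have binom: "of_nat (2 * k choose k) = (fact (2 * k) / (fact k * fact k) :: rat)" for k
    using binomial_fact[of k "2 * k", where ?'a = rat] by (simp add: mult_2)
  define K :: rat where "K = of_nat k"
  have "2 * Suc k = Suc (Suc (2 * k))" by simp
  then have f: "(fact (2 * Suc k) :: rat) = 2 * (K + 1) * (2 * K + 1) * fact (2 * k)"
    by (simp only: fact_Suc) (simp add: K_def algebra_simps)
  have g: "(fact (Suc k) :: rat) = (K + 1) * fact k" by (simp add: K_def add.commute)
  have cancel: "2 * x * y * F / (x * h * (x * h)) = F / (h * h) * (2 * y) / x" if "x \<noteq> 0" for x y F h :: rat
    using that by (simp add: mult_ac)
  have "K + 1 \<noteq> 0" by (simp add: K_def add_nonneg_eq_0_iff)
  then show ?thesis unfolding binom f g K_def[symmetric] by (rule cancel)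
qed

text \<open>Both sides have the same ratio between consecutive \<open>k\<close>. When
  \<open>q\<close> is a power of an odd prime \<open>p\<close>, each factor of the product differs
  from 1 by the square of a multiple of \<open>p\<close>.\<close>

lemma binomial_eq_central_binomial:
  fixes n k :: nat
  assumes "k \<le> n"
  defines "q \<equiv> 2 * of_nat n + 1 :: rat"
  shows "(- 1) ^ k * of_nat (n + k choose (2 * k)) =
    of_nat (2 * k choose k) / 16 ^ k * (\<Prod>j=1..k. 1 - q ^ 2 / (2 * of_nat j - 1) ^ 2)"
  using assms(1)
proof (induction k)
  case (Suc k)
  let ?P = "\<lambda>k. (\<Prod>j=1..k. 1 - q ^ 2 / (2 * of_nat j - 1) ^ 2)"
  define K :: rat where "K = of_nat k"
  define M :: rat where "M = of_nat n"
  \<comment> \<open>With \<open>d = n - k - 1\<close> both binomials take the shape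
    \<open>r + s choose r\<close>, where \<open>s\<close> is \<open>d\<close> or
    \<open>Suc d\<close>.\<close>
  obtain d where d: "n = Suc (k + d)" using Suc.prems by (metis Suc_le_D add_Suc less_eqE)
  have nz: "2 * K + 1 \<noteq> 0" "2 * K + 2 \<noteq> 0" "K + 1 \<noteq> 0"
    by (simp_all add: K_def add_nonneg_eq_0_iff)
  have c1: "(of_nat (n + Suc k choose (2 * Suc k)) :: rat) * ((2 * K + 1) * (2 * K + 2))
      = of_nat (n + k choose (2 * k)) * ((M + K + 1) * (M - K))"
  proof -
    have binom: "of_nat (r + d choose r) = (fact (r + d) / (fact r * fact d) :: rat)" for r d
      using binomial_fact[of r "r + d", where ?'a = rat] by simp
    have n: "n + Suc k = 2 * Suc k + d" "n + k = 2 * k + Suc d" using d by simp_all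
    have "2 * Suc k + d = Suc (2 * k + Suc d)" "2 * Suc k = Suc (Suc (2 * k))" by simp_all
    then have f1: "(fact (2 * Suc k + d) :: rat) = (M + K + 1) * fact (2 * k + Suc d)"
      and f2: "(fact (2 * Suc k) :: rat) = (2 * K + 1) * (2 * K + 2) * fact (2 * k)"
      by (simp_all only: fact_Suc) (simp_all add: d M_def K_def add_ac mult_ac)
    have f3: "(fact (Suc d) :: rat) = (M - K) * fact d" and "M - K \<noteq> 0"
      by (simp_all add: d M_def K_def add_nonneg_eq_0_iff)
    moreover have "s * F / (x * f * g) * x = F / (f * (z * g)) * (s * z)"
      if "x \<noteq> 0" "z \<noteq> 0" for s F x f g z :: rat
      using that by (simp add: field_simps)
    ultimately show ?thesis
      using nz unfolding n binom f1 f2 f3 by simp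
  qed
  have C: "of_nat (n + Suc k choose (2 * Suc k)) =
      of_nat (n + k choose (2 * k)) * ((M + K + 1) * (M - K)) / ((2 * K + 1) * (2 * K + 2))"
    using c1 nz by (simp add: divide_simps del: binomial_Suc_Suc)
  have CB: "of_nat (2 * Suc k choose Suc k) = of_nat (2 * k choose k) * (2 * (2 * K + 1)) / (K + 1)"
    unfolding K_def by (rule of_nat_central_binomial_Suc)
  have P: "?P (Suc k) = ?P k * (1 - q ^ 2 / (2 * K + 1) ^ 2)"
    by (simp add: K_def algebra_simps)
  have q: "q = 2 * M + 1" by (simp add: q_def M_def)
  have IH: "(- 1) ^ k * of_nat (n + k choose (2 * k)) = of_nat (2 * k choose k) / 16 ^ k * ?P k"
    using Suc by simp
  have "of_nat (2 * Suc k choose Suc k) / 16 ^ Suc k * ?P (Suc k)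
      = (of_nat (2 * k choose k) / 16 ^ k * ?P k) *
        (2 * (2 * K + 1) / (16 * (K + 1)) * (1 - q ^ 2 / (2 * K + 1) ^ 2))"
  proof -
    have "c * (2 * x) / y / (16 * S) * (v * w) = c / S * v * (2 * x / (16 * y) * w)"
      for c x y S v w :: rat
      by (simp add: mult_ac)
    then show ?thesis unfolding CB P power_Suc .
  qed
  also have "\<dots> = (- 1) ^ k * of_nat (n + k choose (2 * k)) *
        (2 * (2 * K + 1) / (16 * (K + 1)) * (1 - q ^ 2 / (2 * K + 1) ^ 2))"
    unfolding IH ..
  also have "2 * (2 * K + 1) / (16 * (K + 1)) * (1 - q ^ 2 / (2 * K + 1) ^ 2)
      = - (((M + K + 1) * (M - K)) / ((2 * K + 1) * (2 * K + 2)))"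
  proof -
    \<comment> \<open>Difference of squares:
      \<open>q ^ 2 - (2 * K + 1) ^ 2 = 4 * (M + K + 1) * (M - K)\<close>.\<close>
    have "1 - q ^ 2 / (2 * K + 1) ^ 2 = - (4 * ((M + K + 1) * (M - K))) / (2 * K + 1) ^ 2"
      using nz by (simp add: q divide_simps) (simp add: algebra_simps power2_eq_square)
    moreover have "2 * x / (16 * y) * (- (4 * z) / x ^ 2) = - (z / (x * (2 * y)))"
      if "x \<noteq> 0" "y \<noteq> 0" for x y z :: rat
      using that by (simp add: field_simps power2_eq_square)
    moreover have "2 * K + 2 = 2 * (K + 1)" by simp
    ultimately show ?thesis using nz by metis
  qed
  finally show ?case unfolding C by simp
qed simp

section \<open>Integration of polynomials over the unit interval\<close>

text \<open>The integral over the unit interval, provided that the degree is below \<open>M\<close>.\<close>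

definition poly_integral :: "nat \<Rightarrow> int poly \<Rightarrow> rat" where
  "poly_integral M f = (\<Sum>i<M. of_int (coeff f i) / of_nat (i + 1))"

lemma poly_integral_add: "poly_integral M (f + g) = poly_integral M f + poly_integral M g"
  by (simp add: poly_integral_def sum.distrib add_divide_distrib)

lemma poly_integral_smult: "poly_integral M (smult c f) = of_int c * poly_integral M f"
  by (simp add: poly_integral_def sum_distrib_left)

lemma poly_integral_uminus: "poly_integral M (- f) = - poly_integral M f"
  using poly_integral_smult[of M "- 1" f] by simp

lemma poly_integral_diff: "poly_integral M (f - g) = poly_integral M f - poly_integral M g"
  using poly_integral_add[of M f "- g"] by (simp add: poly_integral_uminus)

lemma poly_integral_sum: "poly_integral M (sum f A) = (\<Sum>i\<in>A. poly_integral M (f i))"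
proof (induction A rule: infinite_finite_induct)
  case (insert x A)
  then show ?case by (simp add: poly_integral_add)
qed (simp_all add: poly_integral_def)

text \<open>Writing one factor \<open>1 - X\<close> as a difference gives two integrals with smaller
  \<open>b\<close>, one of them with \<open>a + 1\<close>; both degrees stay below \<open>M\<close>,
  so no coefficient is cut off.\<close>

lemma poly_integral_beta:
  assumes "a + b < M"
  shows "poly_integral M ([:0, 1:] ^ a * [:1, - 1:] ^ b) = fact a * fact b / fact (a + b + 1)"
  using assms
proof (induction b arbitrary: a)
  case 0
  have "poly_integral M ([:0, 1:] ^ a) = (\<Sum>i<M. if a = i then 1 / of_nat (i + 1) else 0)"
    unfolding poly_integral_def monom_altdef[of 1 a, simplified, symmetric]
    by (intro sum.cong) auto
  then show ?case using 0 by simp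
next
  case (Suc b)
  have "[:0, 1:] ^ a * [:1, - 1:] ^ Suc b
      = [:0, 1:] ^ a * [:1, - 1:] ^ b - [:0, 1:] ^ Suc a * ([:1, - 1:] :: int poly) ^ b"
  proof -
    have "[:1, - 1:] = 1 - [:0, 1 :: int:]" by (simp add: one_pCons)
    then show ?thesis by (simp add: algebra_simps)
  qed
  then have "poly_integral M ([:0, 1:] ^ a * [:1, - 1:] ^ Suc b) =
     fact a * fact b / fact (a + b + 1) - fact (Suc a) * fact b / fact (Suc a + b + 1)"
    using Suc by (simp only: poly_integral_diff)
  also have "\<dots> = fact a * fact (Suc b) / fact (a + Suc b + 1)"
    by (simp add: divide_simps del: of_nat_Suc of_nat_add) (simp add: algebra_simps)
  finally show ?case .
qed

text \<open>Truncation at \<open>p ^ a - 1\<close> keeps every denominator \<open>i + 1\<close>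
  below \<open>p ^ a\<close>, so the prefactor adds one \<open>p\<close> to the \<open>n\<close>
  from the coefficients.\<close>

lemma poly_integral_ploc:
  assumes "prime p" "\<And>i. int p ^ n dvd coeff f i"
  shows "of_nat (p ^ a) * poly_integral (p ^ a - 1) f \<in> ploc p (n + 1)"
proof -
  have "of_nat (p ^ a) * poly_integral (p ^ a - 1) f
      = (\<Sum>i<p ^ a - 1. of_int (coeff f i) * (of_nat (p ^ a) / of_nat (i + 1)))"
    by (simp add: poly_integral_def sum_distrib_left mult_ac)
  also have "\<dots> \<in> ploc p (n + 1)"
    by (intro ploc_sum ploc_mult ploc_of_int prime_power_div_ploc assms) auto
  finally show ?thesis .
qed

section \<open>Beta values modulo the square of the prime\<close>

lemma beta_ploc:
  assumes "prime p" "i + j + 1 < p ^ a"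
  shows "of_nat (p ^ a) * (fact i * fact j / fact (i + j + 1)) \<in> ploc p 1"
  using poly_integral_ploc[OF assms(1), of 0 "[:0, 1:] ^ i * [:1, - 1:] ^ j" a] assms(2)
  by (simp add: poly_integral_beta del: fact_Suc)

text \<open>Rotates \<open>B(i + 1, i + 1)\<close> to \<open>B(i + 1, q - 1 - 2 * i)\<close>: the two are in the ratio of
  \<open>q - 1 choose 2 * i + 1\<close> to \<open>q - 1 choose i\<close>, and \<open>q - 1 choose j\<close> is \<open>(-1) ^ j\<close> modulo \<open>p\<close>.\<close>

lemma beta_rotate:
  fixes p a :: nat
  defines "q \<equiv> p ^ a"
  assumes "prime p" "2 * i + 2 \<le> q"
  shows "of_nat q * (fact i * fact i / fact (2 * i + 1)) +
    (- 1) ^ i * (of_nat q * (fact i * fact (q - 2 - 2 * i) / fact (q - 1 - i))) \<in> ploc p 2"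
proof -
  define B B' :: rat where "B = of_nat q * (fact i * fact i / fact (2 * i + 1))"
    and "B' = of_nat q * (fact i * fact (q - 2 - 2 * i) / fact (q - 1 - i))"
  define c d :: int where "c = int (q - 1 choose i)" and "d = int (q - 1 choose (2 * i + 1))"
  obtain l where l: "q = 2 * i + 2 + l" using assms(3) by (metis less_eqE)
  have nats: "q - 2 - 2 * i = l" "q - 1 - i = i + l + 1" "q - 1 - (2 * i + 1) = l"
    using l by simp_all
  have B: "B \<in> ploc p 1"
    unfolding B_def mult_2 by (rule beta_ploc[OF assms(2), where a = a, folded q_def]) (use l in simp)
  have B': "B' \<in> ploc p 1"
    unfolding B'_def nats by (rule beta_ploc[OF assms(2), where a = a, folded q_def]) (use l in simp)
  \<comment> \<open>In terms of factorials, \<open>B / B'\<close> is exactly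
    \<open>d / c\<close>.\<close>
  have "(of_int c :: rat) = fact (q - 1) / (fact i * fact (i + l + 1))"
    unfolding c_def of_int_of_nat_eq using l by (subst binomial_fact) (simp_all only: nats, simp)
  moreover have "(of_int d :: rat) = fact (q - 1) / (fact (2 * i + 1) * fact l)"
    unfolding d_def of_int_of_nat_eq using l by (subst binomial_fact) (simp_all only: nats, simp)
  moreover have "w * (x * x / y) * (F / (x * z)) = F / (y * v) * (w * (x * v / z))"
    if "x \<noteq> 0" "v \<noteq> 0" for w x y z v F :: rat
    using that by (simp add: mult_ac)
  ultimately have rel: "B * of_int c = of_int d * B'"
    unfolding B_def B'_def nats by (simp only: fact_nonzero not_False_eq_True)
  have c: "of_int (c - (- 1) ^ i) \<in> ploc p 1"
    using prime_power_minus_one_binomial_cong[OF assms(2), of i a] l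
    by (intro ploc_of_int) (simp add: c_def q_def cong_iff_dvd_diff)
  have d: "of_int (d + 1) \<in> ploc p 1"
    using prime_power_minus_one_binomial_cong[OF assms(2), of "2 * i + 1" a] l
    by (intro ploc_of_int) (simp add: d_def q_def cong_iff_dvd_diff)
  \<comment> \<open>Modulo \<open>p\<close>, \<open>c\<close> is \<open>(- 1) ^ i\<close> and
    \<open>d\<close> is \<open>- 1\<close>. As \<open>B\<close> and \<open>B'\<close> are multiples
    of \<open>p\<close>, making these replacements in \<open>B * c = d * B'\<close> costs only
    multiples of \<open>p ^ 2\<close>.\<close>
  have "of_int (d + 1) * B' - of_int (c - (- 1) ^ i) * B \<in> ploc p 2"
    using ploc_diff[OF ploc_mult[OF d B'] ploc_mult[OF c B]] by (simp add: numeral_2_eq_2)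
  also have "of_int (d + 1) * B' - of_int (c - (- 1) ^ i) * B = (- 1) ^ i * B + B'"
    using rel by (simp add: algebra_simps)
  finally have "of_int ((- 1) ^ i) * ((- 1) ^ i * B + B') \<in> ploc p 2"
    by (intro ploc_mult_0) (auto simp del: of_int_power)
  also have "of_int ((- 1) ^ i) * ((- 1) ^ i * B + B') = B + (- 1) ^ i * B'"
    by (simp add: algebra_simps flip: power_mult_distrib)
  finally show ?thesis by (simp add: B_def B'_def)
qed

text \<open>The inner binomials of row \<open>p ^ a\<close> are divisible by \<open>p\<close>;
  oddness gives the top term of the expansion the sign that cancels
  \<open>X ^ (p ^ a)\<close>.\<close>

lemma prime_power_dvd_poly:
  assumes "prime p" "odd p" "a > 0"
  shows "[:int p:] dvd 1 - [:0, 1:] ^ (p ^ a) - [:1, - 1:] ^ (p ^ a)"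
proof -
  define q where "q = p ^ a"
  have "q > 0" "odd q" using assms by (auto simp: q_def prime_gt_0_nat)
  define X where "X = [:0, 1 :: int:]"
  have "[:1, - 1:] = - X + 1" by (simp add: X_def one_pCons)
  then have "[:1, - 1:] ^ q = (\<Sum>k\<le>q. of_nat (q choose k) * (- X) ^ k)"
    by (simp only: binomial_ring) simp
  also have "{..q} = insert 0 (insert q {0<..<q})" using \<open>q > 0\<close> by auto
  also have "(\<Sum>k\<in>\<dots>. of_nat (q choose k) * (- X) ^ k)
     = 1 - X ^ q + (\<Sum>k\<in>{0<..<q}. of_nat (q choose k) * (- X) ^ k)"
    using \<open>q > 0\<close> \<open>odd q\<close> by simp
  finally have "1 - X ^ q - [:1, - 1:] ^ q = - (\<Sum>k\<in>{0<..<q}. of_nat (q choose k) * (- X) ^ k)"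
    by simp
  moreover have "[:int p:] dvd (\<Sum>k\<in>{0<..<q}. of_nat (q choose k) * (- X) ^ k)"
  proof (intro dvd_sum dvd_mult2)
    fix k assume "k \<in> {0<..<q}"
    then have "p dvd (q choose k)"
      using prime_power_dvd_binomial[OF assms(1)] by (simp add: q_def)
    then show "[:int p:] dvd of_nat (q choose k)"
      by (auto simp: of_nat_poly elim!: dvdE)
  qed
  ultimately show ?thesis by (simp add: X_def q_def)
qed

text \<open>Since \<open>1 - x * y = x + y ^ 2\<close>, the sum is geometric in \<open>- x\<close>
  and \<open>y ^ 2\<close> once \<open>y ^ (N + 1)\<close> is taken out. Evenness of
  \<open>N\<close> removes the sign of \<open>(- x) ^ N\<close>.\<close>

lemma geometric_sum_rotated:
  fixes x y :: "'a :: comm_ring_1"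
  assumes "x + y = 1" "even N"
  shows "(1 - x * y) * (\<Sum>i<N. (- 1) ^ i * (x ^ i * y ^ (3 * N - 1 - 2 * i)))
    = y ^ (3 * N + 1) - x ^ N * y ^ (N + 1)"
proof -
  have y: "y = 1 - x" using assms(1) by (simp add: algebra_simps)
  define S where "S = (\<Sum>i<N. (y ^ 2) ^ (N - Suc i) * (- x) ^ i)"
  have "(\<Sum>i<N. (- 1) ^ i * (x ^ i * y ^ (3 * N - 1 - 2 * i))) = y ^ (N + 1) * S"
    unfolding S_def sum_distrib_left
  proof (intro sum.cong refl)
    fix i assume "i \<in> {..<N}"
    then have "3 * N - 1 - 2 * i = (N + 1) + 2 * (N - Suc i)" by auto
    then show "(- 1) ^ i * (x ^ i * y ^ (3 * N - 1 - 2 * i)) = y ^ (N + 1) * ((y ^ 2) ^ (N - Suc i) * (- x) ^ i)"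
      by (simp only: power_add power_mult power_minus[of x]) (simp add: mult_ac)
  qed
  moreover have "1 - x * y = - (- x - y ^ 2)"
    by (simp add: y power2_eq_square algebra_simps)
  ultimately have "(1 - x * y) * (\<Sum>i<N. (- 1) ^ i * (x ^ i * y ^ (3 * N - 1 - 2 * i)))
     = - (y ^ (N + 1) * ((- x - y ^ 2) * S))"
    by (simp only:) (simp only: mult_minus_left mult_minus_right mult.left_commute)
  also have "\<dots> = - (y ^ (N + 1) * ((- x) ^ N - (y ^ 2) ^ N))"
    by (simp only: S_def power_diff_sumr2)
  also have "\<dots> = y ^ (N + 1 + 2 * N) - x ^ N * y ^ (N + 1)"
    using assms(2) by (simp only: power_add power_mult power_minus_even) (simp add: algebra_simps)
  finally show ?thesis by (simp add: algebra_simps)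
qed

text \<open>\<open>l P1\<close> is the sum in question; \<open>P2\<close> and \<open>P3\<close> are
  the rotated integrands, each with \<open>l\<close>-value \<open>- l P1\<close> modulo
  \<open>p ^ 2\<close>. Divisibility of \<open>P1 - P2 - P3\<close> by \<open>p\<close> then yields
  three times the claim.\<close>

lemma central_beta_sum:
  fixes p a N :: nat
  assumes "prime p" "odd p" "a > 0" "p ^ a = 3 * N + 1" "even N"
  shows "(\<Sum>i<N. of_nat (p ^ a) * (fact i * fact i / fact (2 * i + 1))) \<in> ploc p 2"
proof -
  define q where "q = p ^ a"
  have q: "q = 3 * N + 1" using assms(4) by (simp add: q_def)
  define l where "l f = of_nat q * poly_integral (q - 1) f" for f
  define X Y D :: "int poly" where "X = [:0, 1:]" and "Y = [:1, - 1:]" and "D = 1 - X * Y"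
  define P1 where "P1 = (\<Sum>i<N. X ^ i * Y ^ i)"
  define P2 where "P2 = (\<Sum>i<N. (- 1) ^ i * (X ^ i * Y ^ (3 * N - 1 - 2 * i)))"
  define P3 where "P3 = (\<Sum>i<N. (- 1) ^ i * (Y ^ i * X ^ (3 * N - 1 - 2 * i)))"
  have XY: "X + Y = 1" by (simp add: X_def Y_def one_pCons)
  have sgn: "(- 1) ^ i * f = smult ((- 1) ^ i) f" for i and f :: "int poly"
    by (cases "even i") auto
  have l_add: "l (f + g) = l f + l g" and l_diff: "l (f - g) = l f - l g"
    and l_smult: "l (smult c f) = of_int c * l f" for f g c
    by (simp_all add: l_def poly_integral_add poly_integral_diff poly_integral_smult algebra_simps)
  have l_sum: "l (sum f A) = (\<Sum>i\<in>A. l (f i))" for f and A :: "nat set"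
    by (simp add: l_def poly_integral_sum sum_distrib_left)
  have l_beta: "l (X ^ i * Y ^ j) = of_nat q * (fact i * fact j / fact (i + j + 1))"
    if "i + j < q - 1" for i j
    using that by (simp add: l_def X_def Y_def poly_integral_beta del: fact_Suc)

  have l1: "l P1 = (\<Sum>i<N. of_nat q * (fact i * fact i / fact (2 * i + 1)))"
    unfolding P1_def l_sum
  proof (intro sum.cong refl)
    fix i assume "i \<in> {..<N}"
    then have "i + i < q - 1" using q by auto
    then show "l (X ^ i * Y ^ i) = of_nat q * (fact i * fact i / fact (2 * i + 1))"
      by (simp only: l_beta mult_2)
  qed
  have l2: "l P2 = (\<Sum>i<N. (- 1) ^ i * (of_nat q * (fact i * fact (q - 2 - 2 * i) / fact (q - 1 - i))))"
    unfolding P2_def l_sum sgn l_smult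
  proof (intro sum.cong refl)
    fix i assume i: "i \<in> {..<N}"
    have "3 * N - 1 - 2 * i = q - 2 - 2 * i" "i + (3 * N - 1 - 2 * i) + 1 = q - 1 - i"
      "i + (3 * N - 1 - 2 * i) < q - 1"
      using i q by auto
    then show "of_int ((- 1) ^ i) * l (X ^ i * Y ^ (3 * N - 1 - 2 * i)) =
       (- 1) ^ i * (of_nat q * (fact i * fact (q - 2 - 2 * i) / fact (q - 1 - i)))"
      by (simp only: l_beta) simp
  qed
  have l3: "l P3 = l P2"
    unfolding P3_def P2_def l_sum sgn l_smult
  proof (intro sum.cong refl arg_cong2[where f = "(*)"])
    fix i assume i: "i \<in> {..<N}"
    then have *: "i + (3 * N - 1 - 2 * i) < q - 1" "3 * N - 1 - 2 * i + i < q - 1"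
      using q by auto
    show "l (Y ^ i * X ^ (3 * N - 1 - 2 * i)) = l (X ^ i * Y ^ (3 * N - 1 - 2 * i))"
      unfolding mult.commute[of "Y ^ i"] l_beta[OF *(1)] l_beta[OF *(2)] by (simp add: mult_ac add_ac del: fact_Suc)
  qed

  have "D * P1 = 1 - (X * Y) ^ N"
    unfolding D_def P1_def one_diff_power_eq by (simp add: power_mult_distrib)
  moreover have "D * P2 = Y ^ q - X ^ N * Y ^ (N + 1)"
    unfolding D_def P2_def q by (rule geometric_sum_rotated[OF XY assms(5)])
  moreover have "D * P3 = X ^ q - Y ^ N * X ^ (N + 1)"
    unfolding D_def P3_def q mult.commute[of X Y]
    using XY by (intro geometric_sum_rotated assms(5)) (simp add: add.commute)
  \<comment> \<open>The mixed terms of the three numerators combine to a multiple of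
    \<open>X + Y - 1\<close>, which is zero.\<close>
  ultimately have "D * (P1 - P2 - P3) = 1 - X ^ q - Y ^ q + (X * Y) ^ N * (X + Y - 1)"
    by (simp add: algebra_simps power_mult_distrib)
  then have D: "D * (P1 - P2 - P3) = 1 - X ^ q - Y ^ q" by (simp add: XY)
  have "prime_elem [:int p:]"
    using assms(1) by (simp add: prime_elem_const_poly_iff)
  moreover have "[:int p:] dvd D * (P1 - P2 - P3)"
    unfolding D using prime_power_dvd_poly[OF assms(1-3)] by (simp add: X_def Y_def q_def)
  moreover have "\<not> [:int p:] dvd D"
  proof
    assume "[:int p:] dvd D"
    \<comment> \<open>The constant coefficient of \<open>D\<close> is 1.\<close>
    then have "int p dvd coeff D 0" by (simp only: const_poly_dvd_iff)
    then show False using assms(1) by (simp add: D_def X_def Y_def)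
  qed
  ultimately have "[:int p:] dvd P1 - P2 - P3" by (simp add: prime_elem_dvd_mult_iff)
  then have "l (P1 - P2 - P3) \<in> ploc p 2"
    using poly_integral_ploc[OF assms(1), of 1 "P1 - P2 - P3" a]
    by (simp add: const_poly_dvd_iff l_def q_def numeral_2_eq_2)
  moreover have "l P1 + l P2 \<in> ploc p 2"
    unfolding l1 l2 sum.distrib[symmetric] unfolding q_def
  proof (intro ploc_sum beta_rotate[OF assms(1)])
    fix i assume "i \<in> {..<N}"
    then show "2 * i + 2 \<le> p ^ a" using assms(4) by auto
  qed
  \<comment> \<open>As \<open>l P3 = l P2\<close>, this total is \<open>3 * l P1\<close>.\<close>
  ultimately have "l (P1 - P2 - P3) + ((l P1 + l P2) + (l P1 + l P2)) \<in> ploc p 2"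
    by (simp only: ploc_add)
  then have "of_int 3 * l P1 \<in> ploc p 2"
    by (simp add: l_diff l3)
  \<comment> \<open>A common divisor of 3 and \<open>p\<close> divides
    \<open>p ^ a = 3 * N + 1\<close>, hence 1.\<close>
  moreover have "coprime 3 (int p)"
  proof (rule coprimeI)
    fix c :: int assume "c dvd 3" "c dvd int p"
    moreover from this(2) have "c dvd int (p ^ a)" using assms(3) dvd_power[of a "int p"] by (auto intro: dvd_trans)
    ultimately show "is_unit c"
      by (simp add: assms(4) dvd_add_left_iff)
  qed
  ultimately have "l P1 \<in> ploc p 2"
    using ploc_cancel[of 3 "l P1" p 2] by simp
  then show ?thesis unfolding l1 q_def .
qed

section \<open>Central binomial coefficients modulo the square of a prime\<close>

lemma dyadic_ploc:
  assumes "odd p"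
  shows "of_nat c / of_int (2 ^ k) \<in> ploc p 0"
proof -
  have "coprime (2 ^ k) (int p)" using assms by simp
  from ploc_mult_0[OF ploc_inverse_of_int[OF this] ploc_of_nat_0[of c]]
  show ?thesis by (simp add: field_simps)
qed

text \<open>For \<open>n = 3 * m\<close> the \<open>q\<close> of the product formula is
  \<open>p ^ a\<close>, and all \<open>2 * j - 1\<close> are below it. So the correction products
  \<open>w k\<close> are 1 modulo \<open>p ^ 2\<close>.\<close>

lemma central_binomial_lower_sum:
  fixes p a m :: nat
  assumes "prime p" "odd p" "p ^ a = 6 * m + 1"
  shows "(\<Sum>k\<le>3 * m. of_nat (2 * k choose k) / 16 ^ k) - (- 1) ^ m \<in> ploc p 2"
proof -
  define t :: "nat \<Rightarrow> rat" where "t k = of_nat (2 * k choose k) / 16 ^ k" for k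
  define w :: "nat \<Rightarrow> rat" where
    "w k = (\<Prod>j=1..k. 1 - (2 * of_nat (3 * m) + 1) ^ 2 / (2 * of_nat j - 1) ^ 2)" for k
  have "(- 1) ^ m = of_int (\<Sum>k\<le>3 * m. (- 1) ^ k * int (3 * m + k choose (2 * k)))"
    by (simp only: alternating_binomial_sum) simp
  also have "\<dots> = (\<Sum>k\<le>3 * m. (- 1) ^ k * of_nat (3 * m + k choose (2 * k)))"
    by simp
  also have "\<dots> = (\<Sum>k\<le>3 * m. t k * w k)"
    by (intro sum.cong refl) (simp only: atMost_iff binomial_eq_central_binomial t_def w_def)
  finally have "(\<Sum>k\<le>3 * m. t k) - (- 1) ^ m = - (\<Sum>k\<le>3 * m. t k * (w k - 1))"
    by (simp add: sum_subtractf algebra_simps)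
  also have "\<dots> \<in> ploc p 2"
  proof (intro ploc_uminus ploc_sum ploc_mult_0)
    fix k assume k: "k \<in> {..3 * m}"
    show "t k \<in> ploc p 0"
      using dyadic_ploc[OF assms(2), of "2 * k choose k" "4 * k"]
      by (simp add: t_def power_mult)
    show "w k - 1 \<in> ploc p 2"
      unfolding w_def
    proof (intro ploc_unit_prod)
      fix j assume j: "j \<in> {1..k}"
      then have "of_nat (p ^ a) / of_nat (2 * j - 1) \<in> ploc p 1"
        using k assms(3) by (intro prime_power_div_ploc assms) auto
      from ploc_uminus[OF ploc_mult[OF this this]]
      have "- ((of_nat (p ^ a) / of_nat (2 * j - 1)) ^ 2) \<in> ploc p 2"
        by (simp add: power2_eq_square numeral_2_eq_2)
      moreover have "of_nat (2 * j - 1) = (2 * of_nat j - 1 :: rat)"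
        using j by (simp add: of_nat_diff)
      ultimately show "1 - (2 * of_nat (3 * m) + 1) ^ 2 / (2 * of_nat j - 1) ^ 2 - 1 \<in> ploc p 2"
        unfolding assms(3) by (simp add: power_divide add.commute)
    qed
  qed
  finally show ?thesis unfolding t_def .
qed

text \<open>Going from index \<open>n\<close> to \<open>n + 1\<close> brings in the numerator
  \<open>2 * n + 1 = q\<close>; afterwards ratios of consecutive terms are compared. As
  \<open>i\<close> starts at 0, the factorials form \<open>B(i + 1, i + 1)\<close>.\<close>

lemma central_binomial_upper:
  fixes n i :: nat
  defines "q \<equiv> 2 * of_nat n + 1 :: rat"
  shows "of_nat (2 * (n + 1 + i) choose (n + 1 + i)) / 16 ^ (n + 1 + i) =
    of_nat (2 * n choose n) / (4 * 16 ^ n) * ((q * (fact i * fact i / fact (2 * i + 1))) *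
      ((\<Prod>j=1..i. 1 + q / of_nat (2 * j)) * inverse (\<Prod>j\<le>i. 1 + q / of_nat (2 * j + 1))))"
proof (induction i)
  case 0
  have "of_nat (2 * (n + 1 + 0) choose (n + 1 + 0)) / 16 ^ (n + 1 + 0) =
      of_nat (2 * n choose n) * (2 * q) / (of_nat n + 1) / (16 * 16 ^ n)"
  proof -
    have "n + 1 + 0 = Suc n" by simp
    then show ?thesis by (simp only: of_nat_central_binomial_Suc q_def power_Suc)
  qed
  also have "\<dots> = of_nat (2 * n choose n) / (4 * 16 ^ n) * (q * inverse (2 * (of_nat n + 1)))"
  proof -
    have "A * (2 * q) / y / (16 * S) = A / (4 * S) * (q * inverse (2 * y))" for A y S :: rat
      by (simp add: field_simps)
    then show ?thesis .
  qed
  \<comment> \<open>This is the \<open>j = 0\<close> factor of the inverted product.\<close>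
  also have "2 * (of_nat n + 1) = 1 + q" by (simp add: q_def)
  finally show ?case by simp
next
  case (Suc i)
  define k where "k = n + 1 + i"
  define I :: rat where "I = of_nat i"
  have q: "q > 0" by (simp add: q_def add_nonneg_pos)
  have I: "I \<ge> 0" by (simp add: I_def)
  have nz: "q + 2 * I + 2 \<noteq> 0" "q + 2 * I + 3 \<noteq> 0" "2 * I + 2 \<noteq> 0" "2 * I + 3 \<noteq> 0" "I + 1 \<noteq> 0"
    using q I by linarith+
  have K: "2 * of_nat k = q + 2 * I + 1" by (simp add: k_def q_def I_def)
  \<comment> \<open>The ratio of the summands at \<open>k + 1\<close> and \<open>k\<close>,
    rewritten by \<open>2 * k = q + 2 * I + 1\<close>.\<close>
  define r where "r = (q + 2 * I + 2) / (4 * (q + 2 * I + 3))"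
  have K': "2 * (of_nat k + 1) = q + 2 * I + 3" "of_nat k + 1 \<noteq> (0 :: rat)"
    using K nz by (auto simp: algebra_simps)
  have ratio: "2 * (2 * of_nat k + 1) / (of_nat k + 1) / 16 = r"
  proof -
    have "2 * y / x / 16 = y / (4 * (2 * x))" for x y :: rat
      by simp
    then have "2 * (2 * of_nat k + 1) / (of_nat k + 1) / 16 = (2 * of_nat k + 1) / (4 * (2 * (of_nat k + 1 :: rat)))" .
    then show ?thesis by (simp only: K K' r_def) simp
  qed
  then have lhs: "of_nat (2 * Suc k choose Suc k) / 16 ^ Suc k = of_nat (2 * k choose k) / 16 ^ k * r"
    unfolding of_nat_central_binomial_Suc ratio[symmetric] by simp
  have fact: "(fact (Suc i) * fact (Suc i) / fact (2 * Suc i + 1) :: rat) =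
     fact i * fact i / fact (2 * i + 1) * ((I + 1) ^ 2 / ((2 * I + 2) * (2 * I + 3)))"
  proof -
    have "2 * Suc i + 1 = Suc (Suc (2 * i + 1))" by simp
    then have "(fact (2 * Suc i + 1) :: rat) = fact (2 * i + 1) * ((2 * I + 2) * (2 * I + 3))"
      by (simp only: fact_Suc) (simp add: I_def add_ac mult_ac)
    moreover have "(fact (Suc i) * fact (Suc i) :: rat) = fact i * fact i * (I + 1) ^ 2"
      by (simp add: I_def power2_eq_square add_ac)
    ultimately show ?thesis by (simp only: times_divide_times_eq)
  qed
  have prod1: "(\<Prod>j=1..Suc i. 1 + q / of_nat (2 * j)) =
      (\<Prod>j=1..i. 1 + q / of_nat (2 * j)) * (1 + q / (2 * I + 2))"
    by (simp add: I_def algebra_simps)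
  have prod2: "(\<Prod>j\<le>Suc i. 1 + q / of_nat (2 * j + 1)) =
      (\<Prod>j\<le>i. 1 + q / of_nat (2 * j + 1)) * (1 + q / (2 * I + 3))"
    by (simp add: I_def algebra_simps)
  \<comment> \<open>The ratio splits into the change of the Beta part and one new factor from each
    product.\<close>
  have r: "r = (I + 1) ^ 2 / ((2 * I + 2) * (2 * I + 3)) * ((1 + q / (2 * I + 2)) * inverse (1 + q / (2 * I + 3)))"
  proof -
    have "1 + q / (2 * I + 2) = (q + 2 * I + 2) / (2 * I + 2)" "1 + q / (2 * I + 3) = (q + 2 * I + 3) / (2 * I + 3)"
      using nz by (simp_all add: add_divide_distrib[symmetric] divide_add_eq_iff) (simp_all add: add_ac divide_simps)
    moreover have "2 * I + 2 = 2 * (I + 1)" by simp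
    moreover have "x / (4 * y) = z ^ 2 / (2 * z * w) * (x / (2 * z) * inverse (y / w))"
      if "w \<noteq> 0" "z \<noteq> 0" for x y z w :: rat
      using that by (simp add: field_simps power2_eq_square)
    ultimately show ?thesis using nz unfolding r_def by metis
  qed
  have regroup: "u * (q * F * (G * H)) * (f * (g * h)) = u * (q * (F * f) * (G * g * (H * h)))"
    for u F G H f g h :: rat
    by simp
  have "n + 1 + Suc i = Suc k" by (simp add: k_def)
  then show ?case
    by (simp only: lhs Suc.IH[folded k_def] fact prod1 prod2 r inverse_mult_distrib regroup)
qed

lemma central_binomial_upper_sum:
  fixes p a m :: nat
  assumes "prime p" "odd p" "a > 0" "p ^ a = 6 * m + 1"
  shows "(\<Sum>i<2 * m. of_nat (2 * (3 * m + 1 + i) choose (3 * m + 1 + i)) / 16 ^ (3 * m + 1 + i)) \<in> ploc p 2"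
proof -
  define q :: rat where "q = 2 * of_nat (3 * m) + 1"
  have q: "q = of_nat (p ^ a)" unfolding assms(4) by (simp add: q_def)
  define u :: rat where "u = of_nat (2 * (3 * m) choose (3 * m)) / (4 * 16 ^ (3 * m))"
  define b :: "nat \<Rightarrow> rat" where "b i = q * (fact i * fact i / fact (2 * i + 1))" for i
  define w where "w i = (\<Prod>j=1..i. 1 + q / of_nat (2 * j)) * inverse (\<Prod>j\<le>i. 1 + q / of_nat (2 * j + 1))" for i
  have b1: "b i \<in> ploc p 1" and w1: "w i - 1 \<in> ploc p 1" if "i < 2 * m" for i
  proof -
    show "b i \<in> ploc p 1"
      using beta_ploc[OF assms(1), of i i a] that assms(4) by (simp add: b_def q mult_2 del: fact_Suc)
    have *: "1 + q / of_nat j - 1 \<in> ploc p 1" if "0 < j" "j < 6 * m + 1" for j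
      using prime_power_div_ploc[OF assms(1), of j a] that assms(4) by (simp add: q)
    show "w i - 1 \<in> ploc p 1"
      unfolding w_def using that
      by (intro ploc_unit_mult ploc_inverse_unit ploc_unit_prod assms * zero_less_one) auto
  qed
  have u: "u \<in> ploc p 0"
    using dyadic_ploc[OF assms(2), of "2 * (3 * m) choose (3 * m)" "2 + 4 * (3 * m)"]
    by (simp only: u_def power_add power_mult) simp
  have "(\<Sum>i<2 * m. of_nat (2 * (3 * m + 1 + i) choose (3 * m + 1 + i)) / 16 ^ (3 * m + 1 + i))
      = (\<Sum>i<2 * m. u * (b i * w i))"
    unfolding u_def b_def w_def q_def by (intro sum.cong refl central_binomial_upper)
  \<comment> \<open>Knowing \<open>w i\<close> only modulo \<open>p\<close> suffices, because
    \<open>b i\<close> is already a multiple of \<open>p\<close>.\<close>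
  also have "\<dots> = u * ((\<Sum>i<2 * m. b i) + (\<Sum>i<2 * m. b i * (w i - 1)))"
    by (simp add: algebra_simps sum_distrib_left flip: sum.distrib)
  also have "\<dots> \<in> ploc p 2"
  proof (rule ploc_mult_0[OF u ploc_add])
    \<comment> \<open>Here \<open>N = 2 * m\<close>, which is even with
      \<open>3 * N + 1 = p ^ a\<close>.\<close>
    show "(\<Sum>i<2 * m. b i) \<in> ploc p 2"
      unfolding b_def q using assms by (intro central_beta_sum) auto
    show "(\<Sum>i<2 * m. b i * (w i - 1)) \<in> ploc p 2"
      using ploc_mult[OF b1 w1] by (intro ploc_sum) (simp add: numeral_2_eq_2)
  qed
  finally show ?thesis .
qed

section \<open>The quadratic character of 3 and the final assembly\<close>

lemma six_mult_plus_one_power: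
  fixes r a :: nat
  obtains m where "(6 * r + 1) ^ a = 6 * m + 1" "even m \<longleftrightarrow> even (r * a)"
proof -
  have "\<exists>m. (6 * r + 1) ^ a = 6 * m + 1 \<and> (even m \<longleftrightarrow> even (r * a))"
  proof (induction a)
    case (Suc a)
    then obtain m where m: "(6 * r + 1) ^ a = 6 * m + 1" "even m \<longleftrightarrow> even (r * a)" by blast
    \<comment> \<open>The new quotient is \<open>m + r\<close> up to an even number, so parity is
      additive in the exponent.\<close>
    have "(6 * r + 1) ^ Suc a = 6 * (m + r + 6 * m * r) + 1"
      by (simp only: power_Suc m(1)) (simp add: algebra_simps)
    moreover have "even (m + r + 6 * m * r) \<longleftrightarrow> even (r * Suc a)" using m(2) by auto
    ultimately show ?case by blast
  qed simp
  then show ?thesis using that by blast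
qed

text \<open>Reciprocity with 3, modulo which \<open>p\<close> is the square 1; the exponent
  \<open>3 * r\<close> has the parity of \<open>r\<close>.\<close>

lemma Legendre_3:
  assumes "prime p" "p = 6 * r + 1"
  shows "Legendre 3 (int p) = (- 1) ^ r"
proof -
  have "r > 0" using assms by (cases r) auto
  have "int p mod 3 = 1" using assms(2) by presburger
  then have "\<not> [int p = 0] (mod 3)" "[1 ^ 2 = int p] (mod 3)"
    by (simp_all add: cong_def)
  moreover from this(2) have "QuadRes 3 (int p)" unfolding QuadRes_def by blast
  ultimately have "Legendre (int p) 3 = 1" by (simp add: Legendre_def)
  moreover have "Legendre (int 3) (int p) * Legendre (int p) (int 3) = (- 1) ^ ((3 - 1) div 2 * ((p - 1) div 2))"
    using assms \<open>r > 0\<close> by (intro Quadratic_Reciprocity) auto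
  moreover have "(p - 1) div 2 = 3 * r" using assms(2) by simp
  ultimately show ?thesis by (simp add: power_mult)
qed

lemma Jacobi_prime_power: "prime p \<Longrightarrow> Jacobi x (p ^ a) = Legendre x (int p) ^ a"
  by (simp add: Jacobi_def prime_factorization_prime_power)

theorem theorem1p1:
  fixes p a :: nat
  assumes "prime p" and "odd p" and "[p = 1] (mod 3)" and "a > 0"
  shows "rat_cong p 2
           (\<Sum>k = 0..nat \<lfloor>(5 / 6 :: rat) * of_nat (p ^ a)\<rfloor>. of_nat ((2 * k) choose k) / 16 ^ k)
           (of_int (Jacobi 3 (p ^ a)))"
proof -
  have "p mod 6 = 1" using assms(2,3) unfolding cong_def by presburger
  then obtain r where r: "p = 6 * r + 1" by (metis div_mult_mod_eq mult.commute)
  then obtain m where m: "p ^ a = 6 * m + 1" "even m \<longleftrightarrow> even (r * a)"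
    using six_mult_plus_one_power by metis
  have "(- 1) ^ m = ((- 1) ^ (r * a) :: int)"
    using m(2) by (simp add: minus_one_power_iff)
  then have J: "Jacobi 3 (p ^ a) = (- 1) ^ m"
    using Legendre_3[OF assms(1) r] assms(1) by (simp add: Jacobi_prime_power power_mult)
  define t :: "nat \<Rightarrow> rat" where "t k = of_nat (2 * k choose k) / 16 ^ k" for k
  \<comment> \<open>The argument of the floor is \<open>5 * m + 5 / 6\<close>.\<close>
  have "\<lfloor>(5 / 6 :: rat) * of_nat (p ^ a)\<rfloor> = int (5 * m)"
    unfolding m(1) by (intro floor_unique) (auto simp: field_simps)
  then have "nat \<lfloor>(5 / 6 :: rat) * of_nat (p ^ a)\<rfloor> = 5 * m" by simp
  moreover have "(\<Sum>k = 0..5 * m. t k) = (\<Sum>k\<le>3 * m. t k) + (\<Sum>i<2 * m. t (3 * m + 1 + i))"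
  proof -
    have "{0..5 * m} = {..3 * m} \<union> {0 + (3 * m + 1)..<2 * m + (3 * m + 1)}" by auto
    then have "sum t {0..5 * m} = sum t {..3 * m} + sum t {0 + (3 * m + 1)..<2 * m + (3 * m + 1)}"
      by (simp only:) (intro sum.union_disjoint; auto)
    also have "sum t {0 + (3 * m + 1)..<2 * m + (3 * m + 1)} = (\<Sum>i<2 * m. t (3 * m + 1 + i))"
      by (simp only: sum.shift_bounds_nat_ivl atLeast0LessThan add.commute)
    finally show ?thesis .
  qed
  ultimately show ?thesis
    using ploc_add[OF central_binomial_lower_sum[OF assms(1,2) m(1)]
        central_binomial_upper_sum[OF assms(1,2) assms(4) m(1)]]
    unfolding rat_cong_iff_ploc t_def[symmetric] by (simp only: J) (simp add: algebra_simps)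
qed

end
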